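(* Let $w$ be a weight on $\mathbb{R}$. Then the following are equivalent: (a) $w \in A_p^+$ for some $1<p<\infty$. (b) For every $0<\gamma\le\frac12$ and $0<s<1$, there exists $C>0$ such that, for all bounded open intervals $I\subset\mathbb{R}$, $$\frac{1}{|I^{\gamma,-}|}\int_{I^{\gamma,-}} w \le C\, M_s(w,I^{\gamma,+}).$$ (c) There exist $0<\gamma\le\frac12$, $0<s<1$ and $C>0$ such that the inequality $$\frac{1}{|I^{\gamma,-}|}\int_{I^{\gamma,-}} w \le C\, M_s(w,I^{\gamma,+})$$ holds for all bounded open intervals $I\subset\mathbb{R}$.
   Context: Lebesgue measure on $\mathbb{R}$ is denoted $|\cdot|$. For a bounded open interval $I=(a,b)$, $a<b$: $I^-=(a,\frac{a+b}{2})$, $I^+=(\frac{a+b}{2},b)$, and for $0<\gamma\le\frac12$, $I^{\gamma,-}=(a,a+\gamma(b-a))$ and $I^{\gamma,+}=(b-\gamma(b-a),b)$. A weight on $\mathbb{R}$ is a function $w:\mathbb{R}\to[0,\infty]$ which is locally integrable (so finite a.e.) and satisfies $w>0$ a.e. For $1<p<\infty$, a weight $w$ belongs to $A_p^+$ if $$\sup_{I\subset\mathbb{R}}\Big(\frac{1}{|I^-|}\int_{I^-}w\Big)\Big(\frac{1}{|I^+|}\int_{I^+}w^{-1/(p-1)}\Big)^{p-1}<\infty,$$ the supremum being over all bounded open intervals. Maximal median: for an interval $I$, a measurable function $f$ on $I$ that is real-valued a.e., and $0<s<1$, $M_s(f,I)=\sup\{\lambda\in\mathbb{R}:|\{x\in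 I:f(x)<\lambda\}|\le s|I|\}$. *)

theory Defs
  imports "HOL-Analysis.Analysis"
begin

definition weight :: "(real \<Rightarrow> ennreal) \<Rightarrow> bool" where
  "weight w \<longleftrightarrow>
     w \<in> borel_measurable lebesgue \<and>
     (\<forall>K. compact K \<longrightarrow> (\<integral>\<^sup>+x\<in>K. w x \<partial>lebesgue) < \<infinity>) \<and>
     (AE x in lebesgue. 0 < w x)"

text \<open>
  A bounded open interval is given by its endpoints \<open>a < b\<close>. The parts of it with
  \<open>\<gamma> = 1 / 2\<close> are its left and right halves.
\<close>

definition left_part :: "real \<Rightarrow> real \<Rightarrow> real \<Rightarrow> real set" where
  "left_part \<gamma> a b = {a<..<a + \<gamma> * (b - a)}"

definition right_part :: "real \<Rightarrow> real \<Rightarrow> real \<Rightarrow> real set" where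
  "right_part \<gamma> a b = {b - \<gamma> * (b - a)<..<b}"

definition left_half :: "real \<Rightarrow> real \<Rightarrow> real set" where
  "left_half a b = {a<..<(a + b) / 2}"

definition right_half :: "real \<Rightarrow> real \<Rightarrow> real set" where
  "right_half a b = {(a + b) / 2<..<b}"

definition average :: "(real \<Rightarrow> ennreal) \<Rightarrow> real set \<Rightarrow> ennreal" where
  "average f E = (\<integral>\<^sup>+x\<in>E. f x \<partial>lebesgue) / emeasure lebesgue E"

text \<open>
  Real powers on \<open>[0, \<infinity>]\<close>. The values at \<open>0\<close> and \<open>\<infinity>\<close> are the usual limits; note that
  on the reals \<open>0 powr r = 0\<close> also for \<open>r \<le> 0\<close>, which is not what is wanted here.
\<close>

definition ennreal_powr :: "ennreal \<Rightarrow> real \<Rightarrow> ennreal" where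
  "ennreal_powr x r =
     (if r = 0 then 1
      else if x = 0 then (if r < 0 then \<infinity> else 0)
      else if x = \<infinity> then (if r < 0 then 0 else \<infinity>)
      else ennreal (enn2real x powr r))"

definition Ap_plus :: "real \<Rightarrow> (real \<Rightarrow> ennreal) set" where
  "Ap_plus p = {w. weight w \<and>
     (SUP (a, b) \<in> {(a, b). a < b}.
        average w (left_half a b) *
        ennreal_powr (average (\<lambda>x. ennreal_powr (w x) (- 1 / (p - 1))) (right_half a b)) (p - 1))
     < \<infinity>}"

text \<open>
  The supremum is taken in the extended reals, so that no convention for suprema of empty or
  unbounded sets of reals enters; \<open>l\<close> still ranges over the reals only.
\<close>

definition maximal_median :: "real \<Rightarrow> (real \<Rightarrow> ereal) \<Rightarrow> real set \<Rightarrow> ereal" where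
  "maximal_median s f E =
     (SUP l \<in> {l :: real. emeasure lebesgue {x \<in> E. f x < ereal l} \<le> ennreal s * emeasure lebesgue E}.
        ereal l)"

definition median_bound :: "(real \<Rightarrow> ennreal) \<Rightarrow> real \<Rightarrow> real \<Rightarrow> real \<Rightarrow> real \<Rightarrow> real \<Rightarrow> bool" where
  "median_bound w \<gamma> s C a b \<longleftrightarrow>
     enn2ereal (average w (left_part \<gamma> a b))
       \<le> ereal C * maximal_median s (\<lambda>x. enn2ereal (w x)) (right_part \<gamma> a b)"

end

theory Submission
  imports Defs
begin

text \<open>
  That (a) implies (b) is Chebyshev's inequality for the dual weight
  \<open>\<sigma> = w powr (- 1 / (p - 1))\<close>: on the part of \<open>right_part \<gamma> a b\<close> where \<open>w < l\<close>, the dual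
  weight is at least \<open>l powr (- 1 / (p - 1))\<close>, and above the maximal median this part has
  proportion more than \<open>s\<close>. So the average of \<open>\<sigma>\<close> over the right half is bounded below, and the
  one-sided Muckenhoupt condition bounds the average of \<open>w\<close> over the left half by a multiple
  of \<open>l\<close> (lemma \<open>median_bound_of_Ap_plus\<close>).

  The substance is that (c) implies (a). Read contrapositively, (c) says: if the average of
  \<open>w\<close> over the left part of an interval is at least \<open>l\<close>, then the sublevel set
  \<open>{w < \<beta> * l}\<close> fills at most a proportion \<open>s\<close> of the right part, where \<open>\<beta>\<close> is a constant. Since
  \<open>s < 1\<close> may be close to \<open>1\<close>, this must be improved to a power decay of the measure of the
  sublevel sets. Fix \<open>l\<close> and a bounded interval \<open>(a, b)\<close> on which all averages of \<open>w\<close> starting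
  at \<open>a\<close> are at least \<open>l\<close>. The rising sun lemma (\<open>rising_sun\<close>) applied to the primitive of
  \<open>w - l\<close> yields disjoint intervals \<open>(u, v)\<close> such that \<open>w \<ge> l\<close> almost everywhere off their union,
  the average of \<open>w\<close> over \<open>(u, v)\<close> equals \<open>l\<close>, and the averages over all initial pieces \<open>(u, x)\<close>
  are at least \<open>l\<close>. These properties are used from two sides.

  \<^item> The right parts of the intervals \<open>(u, t)\<close>, for \<open>t\<close> decreasing geometrically from \<open>v\<close> to \<open>u\<close>,
    tile \<open>(u, v)\<close>. Hence \<open>{w < \<beta> * l}\<close> fills at most a proportion \<open>s\<close> of \<open>(u, v)\<close>
    (\<open>measure_Int_le_by_right_parts\<close>); the gap between left and right parts does no harm.
  \<^item> Since the average over \<open>(u, v)\<close> is only \<open>l\<close>, Chebyshev's inequality shows that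
    \<open>{w < K * l}\<close> fills at least a proportion \<open>1 - 1 / K\<close> of \<open>(u, v)\<close>.

  Summing over the intervals, the measure of \<open>{w < \<beta> * l}\<close> in \<open>(a, b)\<close> is at most
  \<open>s * (K / (K - 1))\<close> times the measure of \<open>{w < K * l}\<close> (\<open>sublevel_step\<close>). For large \<open>K\<close> this
  factor is less than \<open>1\<close>, so that iteration gives geometric decay (\<open>sublevel_decay\<close>), and
  summation over the layers of \<open>w\<close> bounds the average of \<open>w powr - \<epsilon>\<close> for small \<open>\<epsilon>\<close>
  (\<open>negative_moment_bound\<close>). This is the one-sided Muckenhoupt condition with
  \<open>p = 1 + 1 / \<epsilon>\<close>.
\<close>

section \<open>Rising sun intervals\<close>

lemma components_real_open_interval:
  fixes S :: "real set"
  assumes "open S" "S \<subseteq> {a..b}" "C \<in> components S"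
  obtains u v where "u < v" "a \<le> u" "v \<le> b" "C = {u<..<v}" "u \<notin> S" "v \<notin> S"
proof -
  define u v where "u = Inf C" and "v = Sup C"
  have C: "open C" "connected C" "C \<noteq> {}" "C \<subseteq> S"
    using assms open_components[of S C] in_components_connected[of C S]
      in_components_nonempty[of C S] in_components_subset[of C S] by simp_all
  have bdd: "bdd_below C" "bdd_above C"
    using C(4) assms(2) by (meson bdd_above_Icc bdd_above_mono bdd_below_Icc bdd_below_mono order_trans)+
  have gap: "\<exists>e>0. {x - e..x + e} \<subseteq> C" if "x \<in> C" for x
    using C(1) that by (auto simp: open_contains_cball cball_eq_atLeastAtMost)
  have "C \<subseteq> {u<..<v}"
  proof
    fix x assume "x \<in> C"
    then obtain e where "e > 0" "{x - e..x + e} \<subseteq> C" using gap by blast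
    then have "x - e \<in> C" "x + e \<in> C" by auto
    then have "u \<le> x - e" "x + e \<le> v"
      using bdd by (auto simp: u_def v_def cInf_lower cSup_upper)
    with \<open>e > 0\<close> show "x \<in> {u<..<v}" by auto
  qed
  moreover have "{u<..<v} \<subseteq> C"
  proof
    fix x assume "x \<in> {u<..<v}"
    then obtain y z where "y \<in> C" "y < x" "z \<in> C" "x < z"
      using C(3) bdd by (auto simp: u_def v_def cInf_less_iff less_cSup_iff)
    then show "x \<in> C"
      using C(2) connected_contains_Icc[of C y z] by auto
  qed
  ultimately have eq: "C = {u<..<v}" by blast
  then have "u < v" using C(3) by auto
  \<comment> \<open>An endpoint in \<open>S\<close> could be added to the maximal connected set \<open>C\<close>.\<close>
  have notin: "x \<notin> S" if "x = u \<or> x = v" for x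
  proof
    assume "x \<in> S"
    have "x \<in> closure C"
      using that \<open>u < v\<close> by (auto simp: eq)
    then have "insert x C \<subseteq> closure C" by (simp add: closure_subset)
    then have "connected (insert x C)"
      using connected_intermediate_closure[OF C(2)] by blast
    then have "insert x C \<subseteq> C"
      using components_maximal[OF assms(3)] C(3,4) \<open>x \<in> S\<close> by blast
    then show False using eq that by auto
  qed
  have "{u..v} = closure C" using \<open>u < v\<close> eq by simp
  also have "\<dots> \<subseteq> {a..b}"
    using C(4) assms(2) by (intro closure_minimal) auto
  finally have "a \<le> u" "v \<le> b" using \<open>u < v\<close> by auto
  then show ?thesis using that \<open>u < v\<close> eq notin by blast
qed

text \<open>
  F. Riesz' rising sun lemma. The hypothesis on the left endpoint makes the two values of \<open>G\<close>
  agree on a component starting at \<open>a\<close>, too. The minimum property on the whole component, which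
  goes beyond the equality of the endpoint values, is what makes every initial piece of a
  component have large average.
\<close>

lemma rising_sun:
  fixes G :: "real \<Rightarrow> real"
  assumes cont: "continuous_on {a..b} G"
    and left_min: "\<And>x. x \<in> {a..b} \<Longrightarrow> G a \<le> G x"
  defines "S \<equiv> {x \<in> {a<..<b}. \<exists>y\<in>{x<..b}. G y < G x}"
  shows "open S"
    and "C \<in> components S \<Longrightarrow> \<exists>u v. u < v \<and> a \<le> u \<and> v \<le> b \<and> C = {u<..<v} \<and>
           G v = G u \<and> (\<forall>x\<in>{u..v}. G u \<le> G x)"
proof -
  have "S = (\<Union>y\<in>{a..b}. {x \<in> {a<..<b}. G y < G x} \<inter> {..<y})"
    unfolding S_def by fastforce
  moreover have "open {x \<in> {a<..<b}. G y < G x}" for y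
  proof -
    have "continuous_on {a<..<b} G" using cont by (rule continuous_on_subset) auto
    then have "open (G -` {G y<..} \<inter> {a<..<b})"
      by (rule continuous_on_open_vimage[THEN iffD1, rule_format, rotated]) auto
    moreover have "G -` {G y<..} \<inter> {a<..<b} = {x \<in> {a<..<b}. G y < G x}" by auto
    ultimately show ?thesis by simp
  qed
  ultimately show "open S" by (simp add: open_UN open_Int)
  assume "C \<in> components S"
  obtain u v where uv: "u < v" "a \<le> u" "v \<le> b" "C = {u<..<v}" "u \<notin> S" "v \<notin> S"
    by (rule components_real_open_interval[OF \<open>open S\<close> _ \<open>C \<in> components S\<close>, of a b])
      (auto simp: S_def)
  have inS: "x \<in> S" if "u < x" "x < v" for x
    using in_components_subset[OF \<open>C \<in> components S\<close>] uv(4) that by auto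
  have u_min: "G u \<le> G x" if "u \<le> x" "x \<le> b" for x
  proof (cases "u = a \<or> u = x")
    case True
    then show ?thesis using that left_min by auto
  next
    case False
    then show ?thesis using that uv(1,2,3,5) by (auto simp: S_def not_less)
  qed
  have v_min: "G v \<le> G x" if xv: "u < x" "x < v" for x
  proof (rule ccontr)
    assume less: "\<not> G v \<le> G x"
    have "continuous_on {x..v} G"
      using cont xv uv by (auto elim: continuous_on_subset)
    then obtain z where z: "z \<in> {x..v}" "\<And>y. y \<in> {x..v} \<Longrightarrow> G z \<le> G y"
      using continuous_attains_inf[of "{x..v}" G] xv by auto
    have "G z < G v" using z(2)[of x] less xv by auto
    then have "z < v" using z(1) by (cases "z = v") auto
    then obtain y where y: "y \<in> {z<..b}" "G y < G z"
      using inS[of z] z(1) xv unfolding S_def by auto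
    then have "v < y" using z(1) z(2)[of y] by (cases "y \<le> v") auto
    moreover have "v < b" using \<open>v < y\<close> y(1) by auto
    ultimately have "v \<in> S"
      using y \<open>G z < G v\<close> uv(1,2) by (auto simp: S_def intro!: bexI[of _ y])
    then show False using uv(6) by simp
  qed
  have "G v \<le> G u"
  proof -
    have "(G \<longlongrightarrow> G u) (at u within {a..b})"
      using cont uv(1,2,3) by (auto simp: continuous_on)
    then have "(G \<longlongrightarrow> G u) (at u within {u<..<v})"
      by (rule tendsto_within_subset) (use uv(2,3) in auto)
    moreover have "\<forall>\<^sub>F x in at u within {u<..<v}. G v \<le> G x"
      using v_min by (auto simp: eventually_at_filter)
    moreover have "at u within {u<..<v} \<noteq> bot"
      using uv(1) by (simp add: trivial_limit_within islimpt_greaterThanLessThan1)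
    ultimately show ?thesis by (rule tendsto_lowerbound)
  qed
  moreover have "G u \<le> G v" using u_min uv by auto
  ultimately show "\<exists>u v. u < v \<and> a \<le> u \<and> v \<le> b \<and> C = {u<..<v} \<and>
           G v = G u \<and> (\<forall>x\<in>{u..v}. G u \<le> G x)"
    using uv(1,2,3,4) u_min by (intro exI[of _ u] exI[of _ v]) auto
qed

lemma emeasure_Int_le_by_components:
  fixes S :: "'a::euclidean_space set"
  assumes "open S" and [measurable]: "E \<in> sets lebesgue" "F \<in> sets lebesgue"
    and le: "\<And>C. C \<in> components S \<Longrightarrow>
               emeasure lebesgue (E \<inter> C) \<le> k * emeasure lebesgue (F \<inter> C)"
  shows "emeasure lebesgue (E \<inter> S) \<le> k * emeasure lebesgue (F \<inter> S)"
proof -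
  have opn: "open C" if "C \<in> components S" for C
    using open_components assms(1) that by blast
  have disj: "pairwise disjnt (components S)"
    using components_nonoverlap by (auto simp: pairwise_def disjnt_def)
  have "countable (components S)"
    by (rule countable_disjoint_open_subsets[OF opn disj])
  moreover have "disjoint_family_on (\<lambda>C. X \<inter> C) (components S)" for X
    using disj by (auto simp: disjoint_family_on_def pairwise_def disjnt_def)
  moreover have "X \<inter> S = (\<Union>C\<in>components S. X \<inter> C)" for X
    using Union_components[of S] by blast
  moreover have "X \<inter> C \<in> sets lebesgue" if "X \<in> sets lebesgue" "C \<in> components S" for X C
    using opn[OF that(2)] that(1) by auto
  ultimately have sum: "emeasure lebesgue (X \<inter> S) =
      (\<integral>\<^sup>+C. emeasure lebesgue (X \<inter> C) \<partial>count_space (components S))"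
    if "X \<in> sets lebesgue" for X
    using that emeasure_UN_countable[of "components S" "\<lambda>C. X \<inter> C" lebesgue] by simp
  show ?thesis
    unfolding sum[OF assms(2)] sum[OF assms(3)]
    by (subst nn_integral_cmult[symmetric]) (auto intro!: nn_integral_mono le)
qed

section \<open>Densities and averages\<close>

text \<open>
  The right part of \<open>(u, t)\<close> is what remains of \<open>(u, t)\<close> after shrinking it by the factor
  \<open>1 - \<gamma>\<close> towards \<open>u\<close>. Splitting off \<open>n\<close> right parts bounds \<open>E\<close> by the proportion \<open>s\<close> except on a
  remainder of proportion \<open>(1 - \<gamma>) ^ n\<close>, which tends to \<open>0\<close>.
\<close>

lemma measure_Int_le_by_right_parts:
  assumes [measurable]: "E \<in> sets lebesgue" and "0 < \<gamma>" "\<gamma> < 1" "s \<le> 1" "u < v"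
    and part: "\<And>t. u < t \<Longrightarrow> t \<le> v \<Longrightarrow>
                 measure lebesgue (E \<inter> right_part \<gamma> u t) \<le> s * (\<gamma> * (t - u))"
  shows "measure lebesgue (E \<inter> {u<..<v}) \<le> s * (v - u)"
proof -
  have bound: "measure lebesgue (E \<inter> {u<..<t}) \<le> (s + (1 - s) * (1 - \<gamma>) ^ n) * (t - u)"
    if "u < t" "t \<le> v" for t n
    using that
  proof (induction n arbitrary: t)
    case 0
    have "measure lebesgue (E \<inter> {u<..<t}) \<le> measure lebesgue {u<..<t}"
      by (intro measure_mono_fmeasurable) auto
    then show ?case using 0 by simp
  next
    case (Suc n)
    define t' where "t' = u + (1 - \<gamma>) * (t - u)"
    have t': "u < t'" "t' < t" "t' = t - \<gamma> * (t - u)"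
      using mult_pos_pos[of \<gamma> "t - u"] mult_pos_pos[of "1 - \<gamma>" "t - u"] Suc.prems assms(2,3)
      by (simp_all add: t'_def algebra_simps)
    have "E \<inter> {x<..<y} \<in> lmeasurable" for x y
      using fmeasurable_Int_fmeasurable[of "{x<..<y}" lebesgue E] by (simp add: Int_commute)
    then have fin: "E \<inter> {u<..<t'} \<in> lmeasurable" "E \<inter> right_part \<gamma> u t \<in> lmeasurable"
      by (simp_all add: right_part_def)
    have point: "{t'} \<in> lmeasurable" by (simp add: lmeasurable_compact)
    have null: "{t'} \<in> null_sets lebesgue" by simp
    have "E \<inter> {u<..<t} \<subseteq> (E \<inter> {u<..<t'} \<union> E \<inter> right_part \<gamma> u t) \<union> {t'}"
      using t' by (auto simp: right_part_def)
    then have "measure lebesgue (E \<inter> {u<..<t}) \<le>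
        measure lebesgue ((E \<inter> {u<..<t'} \<union> E \<inter> right_part \<gamma> u t) \<union> {t'})"
      using fin point by (intro measure_mono_fmeasurable fmeasurable.Un) auto
    also have "\<dots> = measure lebesgue (E \<inter> {u<..<t'} \<union> E \<inter> right_part \<gamma> u t)"
      using fin null by (intro measure_Un_null_set) (auto simp: fmeasurableD)
    also have "\<dots> \<le> measure lebesgue (E \<inter> {u<..<t'}) + measure lebesgue (E \<inter> right_part \<gamma> u t)"
      using fin by (intro measure_Un_le) (auto simp: fmeasurableD)
    also have "\<dots> \<le> (s + (1 - s) * (1 - \<gamma>) ^ n) * (t' - u) + s * (\<gamma> * (t - u))"
      using Suc.IH[of t'] part[of t] Suc.prems t' by (intro add_mono) auto
    also have "\<dots> = (s + (1 - s) * (1 - \<gamma>) ^ Suc n) * (t - u)"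
      by (simp add: t'_def algebra_simps)
    finally show ?case .
  qed
  have "(\<lambda>n. (1 - \<gamma>) ^ n) \<longlonglongrightarrow> 0"
    using \<open>0 < \<gamma>\<close> \<open>\<gamma> < 1\<close> by (intro LIMSEQ_realpow_zero) simp_all
  then have "(\<lambda>n. (s + (1 - s) * (1 - \<gamma>) ^ n) * (v - u)) \<longlonglongrightarrow> (s + (1 - s) * 0) * (v - u)"
    by (intro tendsto_mult tendsto_add tendsto_const)
  then have "measure lebesgue (E \<inter> {u<..<v}) \<le> (s + (1 - s) * 0) * (v - u)"
    by (rule LIMSEQ_le_const) (use bound[of v] \<open>u < v\<close> in blast)
  then show ?thesis by simp
qed

text \<open>
  By Lebesgue's differentiation theorem, the averages over \<open>(x, y)\<close> tend to \<open>g x\<close> as \<open>y\<close> tends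
  to \<open>x\<close>, for almost every \<open>x\<close>.
\<close>

lemma AE_ge_if_forward_averages_ge:
  fixes g :: "real \<Rightarrow> real"
  assumes "\<And>a b. g integrable_on {a..b}"
  shows "AE x in lebesgue. \<forall>b>x. (\<forall>y. x < y \<and> y \<le> b \<longrightarrow> l * (y - x) \<le> integral {x..y} g) \<longrightarrow> l \<le> g x"
proof -
  have "\<And>a b. g integrable_on cbox a b" using assms by simp
  then obtain N where N: "negligible N"
    "\<And>x e. x \<notin> N \<Longrightarrow> 0 < e \<Longrightarrow> \<exists>d>0. \<forall>h. 0 < h \<and> h < d \<longrightarrow>
       norm (integral (cbox x (x + h *\<^sub>R One)) g /\<^sub>R h ^ DIM(real) - g x) < e"
    using integrable_ccontinuous_explicit[of g] by metis
  have "l \<le> g x" if "x \<notin> N" "x < b" and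
      ge: "\<And>y. x < y \<Longrightarrow> y \<le> b \<Longrightarrow> l * (y - x) \<le> integral {x..y} g" for x b
  proof (rule ccontr)
    assume "\<not> l \<le> g x"
    then obtain d where d: "d > 0" "\<And>h. 0 < h \<Longrightarrow> h < d \<Longrightarrow> \<bar>integral {x..x + h} g / h - g x\<bar> < l - g x"
      using N(2)[OF \<open>x \<notin> N\<close>, of "l - g x"] by (auto simp: divide_inverse mult.commute)
    define h where "h = min (d / 2) (b - x)"
    have h: "0 < h" "h < d" "x + h \<le> b" using d(1) \<open>x < b\<close> by (auto simp: h_def)
    have "l \<le> integral {x..x + h} g / h"
      using ge[of "x + h"] h by (simp add: field_simps)
    with d(2)[of h] h show False by (auto simp: abs_if split: if_splits)
  qed
  then show ?thesis
    using N(1) by (intro AE_I'[of N]) (auto simp: negligible_iff_null_sets)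
qed

section \<open>Decay of sublevel sets\<close>

text \<open>
  The assumption \<open>sparse\<close> is the median condition (c) in contrapositive form, for the
  real-valued version of the weight.
\<close>

locale sparse_sublevels =
  fixes g :: "real \<Rightarrow> real" and \<gamma> s \<beta> :: real
  assumes measurable_g [measurable]: "g \<in> borel_measurable lebesgue"
    and nonneg: "0 \<le> g x"
    and locally_integrable: "g integrable_on {a..b}"
    and \<gamma>: "0 < \<gamma>" "\<gamma> < 1"
    and s: "0 < s" "s < 1"
    and \<beta>: "0 < \<beta>" "\<beta> < 1"
    and sparse: "u < t \<Longrightarrow> 0 < l \<Longrightarrow> l * (\<gamma> * (t - u)) \<le> integral {u..u + \<gamma> * (t - u)} g \<Longrightarrow>
      measure lebesgue ({x. g x < \<beta> * l} \<inter> right_part \<gamma> u t) \<le> s * (\<gamma> * (t - u))"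
begin

lemma sublevel_sets [measurable]: "{x. g x < c} \<in> sets lebesgue"
  using borel_measurable_less[OF measurable_g borel_measurable_const[of c]] by simp

lemma lmeasurable_sublevel: "{x. g x < c} \<inter> {a<..<b} \<in> lmeasurable"
  using fmeasurable_Int_fmeasurable[of "{a<..<b}" lebesgue "{x. g x < c}"]
  by (simp add: Int_commute)

lemma integral_split:
  assumes "a \<le> x" "x \<le> y"
  shows "integral {a..y} g = integral {a..x} g + integral {x..y} g"
  using Henstock_Kurzweil_Integration.integral_combine[OF assms locally_integrable] by simp

lemma integral_mono_right:
  assumes "a \<le> x" "x \<le> y"
  shows "integral {a..x} g \<le> integral {a..y} g"
  using integral_split[OF assms] Henstock_Kurzweil_Integration.integral_nonneg[OF locally_integrable[of x y]] nonneg
  by simp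

text \<open>
  A small average forces a large sublevel set.
\<close>

lemma Chebyshev:
  assumes "u < v" "0 < c"
  shows "(v - u) - integral {u..v} g / c \<le> measure lebesgue ({x. g x < c} \<inter> {u<..<v})"
proof -
  define A where "A = {u..v} - {x. g x < c}"
  have A: "A \<in> lmeasurable" "A \<subseteq> {u..v}"
    unfolding A_def by (auto intro: fmeasurable_Diff)
  have "set_integrable lebesgue {u..v} g"
    using locally_integrable nonneg by (intro nonnegative_absolutely_integrable_1)
  then have "set_integrable lebesgue A g"
    by (rule set_integrable_subset) (use A fmeasurableD in auto)
  then have gA: "g integrable_on A" by (rule set_lebesgue_integral_eq_integral)
  have "c * measure lebesgue A = integral A (\<lambda>_. c)"
    using lmeasure_integral[OF A(1)] by (simp add: integral_mult_right[symmetric] del: integral_mult_right)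
  also have "\<dots> \<le> integral A g"
    using gA A(1) by (intro integral_le integrable_on_const) (auto simp: A_def)
  also have "\<dots> \<le> integral {u..v} g"
    using gA A(2) locally_integrable nonneg by (intro integral_subset_le) auto
  finally have "measure lebesgue A \<le> integral {u..v} g / c"
    using \<open>0 < c\<close> by (simp add: field_simps)
  moreover have "v - u \<le> measure lebesgue ({x. g x < c} \<inter> {u<..<v}) + measure lebesgue A"
  proof -
    have "measure lebesgue {u<..<v} \<le> measure lebesgue ({x. g x < c} \<inter> {u<..<v} \<union> A)"
      using A lmeasurable_sublevel
      by (intro measure_mono_fmeasurable fmeasurable.Un) (auto simp: A_def)
    also have "\<dots> \<le> measure lebesgue ({x. g x < c} \<inter> {u<..<v}) + measure lebesgue A"
      using A lmeasurable_sublevel by (intro measure_Un_le) (auto simp: fmeasurableD)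
    finally show ?thesis using \<open>u < v\<close> by simp
  qed
  ultimately show ?thesis by simp
qed

text \<open>
  This is the heart of the matter. On each rising sun interval for \<open>g - l\<close>, the set
  \<open>{g < \<beta> * l}\<close> is sparse because all initial pieces have average at least \<open>l\<close>, and \<open>{g < K * l}\<close> is
  dense because the whole interval has average exactly \<open>l\<close>.
\<close>

lemma sublevel_step:
  assumes "a < b" "0 < l" "1 < K"
    and ge: "\<And>x. x \<in> {a..b} \<Longrightarrow> l * (x - a) \<le> integral {a..x} g"
  shows "measure lebesgue ({x. g x < \<beta> * l} \<inter> {a<..<b})
       \<le> s * (K / (K - 1)) * measure lebesgue ({x. g x < K * l} \<inter> {a<..<b})"
proof -
  define E F where "E = {x. g x < \<beta> * l}" and "F = {x. g x < K * l}"
  define k where "k = s * (K / (K - 1))"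
  define G where "G x = integral {a..x} g - l * x" for x
  define S where "S = {x \<in> {a<..<b}. \<exists>y\<in>{x<..b}. G y < G x}"
  have k: "0 \<le> k" using s assms(3) by (simp add: k_def)
  have EF [measurable]: "E \<in> sets lebesgue" "F \<in> sets lebesgue"
    by (simp_all add: E_def F_def sublevel_sets)
  have fin: "E \<inter> {u<..<v} \<in> lmeasurable" "F \<inter> {u<..<v} \<in> lmeasurable" for u v
    by (simp_all add: E_def F_def lmeasurable_sublevel)
  have cont: "continuous_on {a..b} G"
    unfolding G_def
    by (intro continuous_intros indefinite_integral_continuous_1 locally_integrable)
  have G_ge: "G a \<le> G x" if "x \<in> {a..b}" for x
    using ge[OF that] by (simp add: G_def algebra_simps)
  have int_G: "integral {x..y} g = G y - G x + l * (y - x)" if "a \<le> x" "x \<le> y" for x y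
    using integral_split[OF that] by (simp add: G_def algebra_simps)
  have "open S"
    unfolding S_def using rising_sun(1)[OF cont G_ge] .
  have on_component: "emeasure lebesgue (E \<inter> C) \<le> ennreal k * emeasure lebesgue (F \<inter> C)"
    if C_in: "C \<in> components S" for C
  proof -
    obtain u v where uv: "u < v" "a \<le> u" "v \<le> b" and C: "C = {u<..<v}"
      and G: "G v = G u" "\<And>x. x \<in> {u..v} \<Longrightarrow> G u \<le> G x"
      using rising_sun(2)[OF cont G_ge C_in[unfolded S_def]] by blast
    have "measure lebesgue (E \<inter> {u<..<v}) \<le> s * (v - u)"
    proof (rule measure_Int_le_by_right_parts[OF EF(1) \<gamma> _ uv(1)])
      fix t assume t: "u < t" "t \<le> v"
      define d where "d = \<gamma> * (t - u)"
      have "0 \<le> d" "d \<le> t - u"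
        using \<gamma> t mult_right_mono[of \<gamma> 1 "t - u"] by (auto simp: d_def)
      then have *: "u + \<gamma> * (t - u) \<in> {u..v}"
        using t(2) by (simp flip: d_def)
      then have "l * (\<gamma> * (t - u)) \<le> integral {u..u + \<gamma> * (t - u)} g"
        using int_G[of u "u + \<gamma> * (t - u)"] G(2)[OF *] uv(2) by simp
      then show "measure lebesgue (E \<inter> right_part \<gamma> u t) \<le> s * (\<gamma> * (t - u))"
        unfolding E_def using t \<open>0 < l\<close> by (intro sparse)
    qed (use s in simp)
    moreover have "v - u \<le> K / (K - 1) * measure lebesgue (F \<inter> {u<..<v})"
    proof -
      have "l * (v - u) / (K * l) = (v - u) / K" using \<open>0 < l\<close> by simp
      then have "(v - u) - (v - u) / K \<le> measure lebesgue (F \<inter> {u<..<v})"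
        using Chebyshev[of u v "K * l"] int_G[of u v] G(1) uv assms(2,3) by (simp add: F_def)
      then have "(v - u) * ((K - 1) / K) \<le> measure lebesgue (F \<inter> {u<..<v})"
        using assms(2,3) by (simp add: field_simps)
      then show ?thesis using assms(3) by (simp add: field_simps)
    qed
    ultimately have "measure lebesgue (E \<inter> {u<..<v}) \<le> k * measure lebesgue (F \<inter> {u<..<v})"
      using s mult_left_mono[of "v - u" _ s] by (fastforce simp: k_def mult.assoc)
    then show ?thesis
      using k fin by (simp add: C emeasure_eq_measure2 ennreal_mult'[symmetric] ennreal_leI)
  qed
  \<comment> \<open>A point of \<open>(a, b) - S\<close> has all forward averages at least \<open>l\<close>, so the sublevel set
    \<open>E\<close> is contained in \<open>S\<close> up to a null set.\<close>
  have "AE x in lebesgue. x \<in> {a<..<b} - S \<longrightarrow> l \<le> g x"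
    using AE_ge_if_forward_averages_ge[OF locally_integrable, of l]
  proof eventually_elim
    case (elim x)
    show ?case
    proof
      assume x: "x \<in> {a<..<b} - S"
      have "l * (y - x) \<le> integral {x..y} g" if "x < y" "y \<le> b" for y
        using x that int_G[of x y] by (force simp: S_def)
      then show "l \<le> g x" using elim x by auto
    qed
  qed
  moreover have "\<beta> * l \<le> l" using \<beta> \<open>0 < l\<close> by simp
  moreover have "S \<subseteq> {a<..<b}" by (auto simp: S_def)
  ultimately have "AE x in lebesgue. x \<in> E \<inter> {a<..<b} \<longleftrightarrow> x \<in> E \<inter> S"
    by (auto simp: E_def elim!: eventually_mono)
  then have "emeasure lebesgue (E \<inter> {a<..<b}) = emeasure lebesgue (E \<inter> S)"
    using \<open>open S\<close> by (intro emeasure_eq_AE) auto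
  also have "\<dots> \<le> ennreal k * emeasure lebesgue (F \<inter> S)"
    by (rule emeasure_Int_le_by_components[OF \<open>open S\<close> EF on_component])
  also have "\<dots> \<le> ennreal k * emeasure lebesgue (F \<inter> {a<..<b})"
    using \<open>S \<subseteq> {a<..<b}\<close> by (intro mult_left_mono emeasure_mono) auto
  finally have "measure lebesgue (E \<inter> {a<..<b}) \<le> k * measure lebesgue (F \<inter> {a<..<b})"
    using k fin by (simp add: emeasure_eq_measure2 ennreal_mult'[symmetric])
  then show ?thesis by (simp add: E_def F_def k_def)
qed

text \<open>
  Step \<open>n\<close> applies the previous lemma at the level \<open>l = (\<beta> / K) ^ n * c / K\<close>, so that
  \<open>K * l\<close> is the current level and \<open>\<beta> * l\<close> the next one.
\<close>

lemma sublevel_decay: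
  assumes "a < b" "0 < c" "1 < K"
    and ge: "\<And>x. x \<in> {a..b} \<Longrightarrow> c * (x - a) \<le> integral {a..x} g"
  shows "measure lebesgue ({x. g x < (\<beta> / K) ^ n * c} \<inter> {a<..<b})
       \<le> (s * (K / (K - 1))) ^ n * (b - a)"
proof (induction n)
  case 0
  have "measure lebesgue ({x. g x < c} \<inter> {a<..<b}) \<le> measure lebesgue {a<..<b}"
    by (intro measure_mono_fmeasurable) auto
  then show ?case using assms(1) by simp
next
  case (Suc n)
  define l where "l = (\<beta> / K) ^ n * c / K"
  have "(\<beta> / K) ^ n \<le> 1" using \<beta> assms(3) by (intro power_le_one) auto
  then have "(\<beta> / K) ^ n * c \<le> 1 * c" using assms(2) by (intro mult_right_mono) auto
  also have "\<dots> \<le> K * c" using assms(2,3) by simp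
  finally have l: "0 < l" "l \<le> c"
    using \<beta> assms(2,3) by (auto simp: l_def field_simps)
  have "measure lebesgue ({x. g x < \<beta> * l} \<inter> {a<..<b})
       \<le> s * (K / (K - 1)) * measure lebesgue ({x. g x < K * l} \<inter> {a<..<b})"
  proof (rule sublevel_step[OF assms(1) l(1) assms(3)])
    fix x assume "x \<in> {a..b}"
    then show "l * (x - a) \<le> integral {a..x} g"
      using ge[of x] l(2) mult_right_mono[of l c "x - a"] by auto
  qed
  also have "\<dots> \<le> s * (K / (K - 1)) * ((s * (K / (K - 1))) ^ n * (b - a))"
    using Suc.IH s assms(3) by (intro mult_left_mono) (simp_all add: l_def)
  finally show ?case
    using assms(3) by (simp add: l_def mult_ac)
qed

text \<open>
  The decay of sublevel sets requires that all averages starting at the left endpoint be large.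
  If only those reaching beyond \<open>m\<close> are known to be large, the left endpoint is moved to a minimum
  of the primitive of \<open>g - c\<close> on \<open>[a, m]\<close>.
\<close>

lemma obtain_good_left_endpoint:
  assumes "a \<le> m" "m \<le> b"
    and ge: "\<And>x. x \<in> {m..b} \<Longrightarrow> c * (x - a) \<le> integral {a..x} g"
  obtains a' where "a \<le> a'" "a' \<le> m" "\<And>x. x \<in> {a'..b} \<Longrightarrow> c * (x - a') \<le> integral {a'..x} g"
proof -
  define G where "G x = integral {a..x} g - c * x" for x
  have "continuous_on {a..m} G"
    unfolding G_def
    by (intro continuous_intros indefinite_integral_continuous_1 locally_integrable)
  then obtain a' where a': "a' \<in> {a..m}" "\<And>x. x \<in> {a..m} \<Longrightarrow> G a' \<le> G x"
    using continuous_attains_inf[of "{a..m}" G] assms(1) by auto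
  have "c * (x - a') \<le> integral {a'..x} g" if x: "x \<in> {a'..b}" for x
  proof -
    have "G a' \<le> G x"
    proof (cases "x \<le> m")
      case True
      then show ?thesis using a' x by auto
    next
      case False
      then have "G a \<le> G x" using ge[of x] x by (simp add: G_def algebra_simps)
      then show ?thesis using a'(2)[of a] assms(1) by auto
    qed
    then show ?thesis
      using integral_split[of a a' x] a' x by (simp add: G_def algebra_simps)
  qed
  then show ?thesis using that a'(1) by auto
qed

text \<open>
  On the layer \<open>\<theta> ^ Suc n * c \<le> g < \<theta> ^ n * c\<close> with \<open>\<theta> = \<beta> / K\<close>, the function
  \<open>g powr - \<epsilon>\<close> is at most \<open>c powr - \<epsilon> * q ^ Suc n\<close>, while the layer has measure at most
  \<open>r ^ n * (b - a)\<close>. The resulting geometric series has the ratio \<open>q * r\<close>.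
\<close>

lemma negative_moment:
  assumes "a < b" "0 < c" "1 < K" "0 < \<epsilon>"
    and ge: "\<And>x. x \<in> {a..b} \<Longrightarrow> c * (x - a) \<le> integral {a..x} g"
  defines "q \<equiv> (\<beta> / K) powr - \<epsilon>" and "r \<equiv> s * (K / (K - 1))"
  assumes "q * r < 1"
  shows "(\<integral>\<^sup>+x\<in>{a<..<b}. ennreal (g x powr - \<epsilon>) \<partial>lebesgue)
       \<le> ennreal (c powr - \<epsilon> * (1 + q / (1 - q * r)) * (b - a))"
proof -
  define \<theta> where "\<theta> = \<beta> / K"
  have \<theta>: "0 < \<theta>" "\<theta> < 1" using \<beta> assms(3) by (auto simp: \<theta>_def)
  have q: "0 < q" using \<beta> assms(3) by (simp add: q_def)
  have r: "0 < r" using s assms(3) by (simp add: r_def)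
  have [measurable]: "{a<..<b} \<in> sets lebesgue" by simp
  define L where "L n = {x. g x < \<theta> ^ n * c} \<inter> {a<..<b}" for n
  have [measurable]: "L n \<in> sets lebesgue" for n
    unfolding L_def by (rule fmeasurableD[OF lmeasurable_sublevel])
  have L: "emeasure lebesgue (L n) \<le> ennreal (r ^ n * (b - a))" for n
    using sublevel_decay[OF assms(1,2,3) ge, of n] r assms(1) lmeasurable_sublevel
    by (simp add: L_def \<theta>_def r_def emeasure_eq_measure2 ennreal_leI)
  have layers: "ennreal (g x powr - \<epsilon>) * indicator {a<..<b} x \<le>
      ennreal (c powr - \<epsilon>) * (indicator {a<..<b} x + (\<Sum>n. ennreal (q ^ Suc n) * indicator (L n) x))"
    (is "_ \<le> _ * (_ + (\<Sum>n. ?f n x))") for x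
  proof (cases "x \<in> {a<..<b} \<and> g x > 0")
    case False
    then show ?thesis using nonneg[of x] by (auto simp: indicator_def)
  next
    case x: True
    show ?thesis
    proof (cases "c \<le> g x")
      case True
      then have "g x powr - \<epsilon> \<le> c powr - \<epsilon>"
        using assms(2,4) by (intro powr_mono2') auto
      then have "ennreal (g x powr - \<epsilon>) \<le> ennreal (c powr - \<epsilon>) * (1 + 0)"
        by (simp add: ennreal_leI)
      also have "\<dots> \<le> ennreal (c powr - \<epsilon>) * (1 + (\<Sum>n. ?f n x))"
        by (intro mult_left_mono add_left_mono) auto
      finally show ?thesis using x by simp
    next
      case False
      \<comment> \<open>The layer of \<open>x\<close> is found from the first power of \<open>\<theta>\<close> that brings \<open>c\<close> below \<open>g x\<close>.\<close>
      have "\<exists>n. \<theta> ^ n * c \<le> g x"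
        using real_arch_pow_inv[of "g x / c" \<theta>] x \<theta> assms(2)
        by (auto simp: field_simps intro: less_imp_le)
      then obtain N where N: "\<theta> ^ N * c \<le> g x" "\<And>n. n < N \<Longrightarrow> \<not> \<theta> ^ n * c \<le> g x"
        using exists_least_iff[of "\<lambda>n. \<theta> ^ n * c \<le> g x"] by blast
      then obtain n where n: "N = Suc n" using False by (cases N) auto
      then have xL: "x \<in> L n" using N(2)[of n] x by (simp add: L_def)
      have "g x powr - \<epsilon> \<le> (\<theta> ^ Suc n * c) powr - \<epsilon>"
        using N(1) n \<theta> assms(2,4) by (intro powr_mono2') auto
      also have "\<dots> = c powr - \<epsilon> * q ^ Suc n"
        using \<theta> assms(2) unfolding q_def \<theta>_def[symmetric]
        by (simp add: powr_mult powr_realpow[symmetric] powr_powr powr_power mult_ac del: power_Suc)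
      finally have "ennreal (g x powr - \<epsilon>) \<le> ennreal (c powr - \<epsilon>) * ?f n x"
        using q xL by (simp add: ennreal_mult'[symmetric] ennreal_leI)
      also have "?f n x = (\<Sum>i\<in>{n}. ?f i x)" by (subst sum.insert) auto
      also have "\<dots> \<le> (\<Sum>i. ?f i x)" by (intro sum_le_suminf summableI) auto
      also have "\<dots> \<le> 1 + (\<Sum>i. ?f i x)" by simp
      finally show ?thesis using x by (simp add: mult_left_mono)
    qed
  qed
  have summable: "summable (\<lambda>n. (q * r) ^ n)"
    using assms(8) q r by (intro summable_geometric) simp
  have "(\<integral>\<^sup>+x\<in>{a<..<b}. ennreal (g x powr - \<epsilon>) \<partial>lebesgue)
     \<le> (\<integral>\<^sup>+x. ennreal (c powr - \<epsilon>) * (indicator {a<..<b} x + (\<Sum>n. ?f n x)) \<partial>lebesgue)"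
    by (intro nn_integral_mono layers)
  also have "\<dots> = ennreal (c powr - \<epsilon>) * (\<integral>\<^sup>+x. indicator {a<..<b} x + (\<Sum>n. ?f n x) \<partial>lebesgue)"
    by (rule nn_integral_cmult) measurable
  also have "(\<integral>\<^sup>+x. indicator {a<..<b} x + (\<Sum>n. ?f n x) \<partial>lebesgue) =
      (\<integral>\<^sup>+x. indicator {a<..<b} x \<partial>lebesgue) + (\<Sum>n. \<integral>\<^sup>+x. ?f n x \<partial>lebesgue)"
    by (subst nn_integral_add, measurable) (simp add: nn_integral_suminf)
  also have "ennreal (c powr - \<epsilon>) * \<dots> = ennreal (c powr - \<epsilon>) * (emeasure lebesgue {a<..<b} +
      (\<Sum>n. ennreal (q ^ Suc n) * emeasure lebesgue (L n)))"
    by (simp add: nn_integral_cmult del: emeasure_completion)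
  also have "\<dots> \<le> ennreal (c powr - \<epsilon>) * (ennreal (b - a) +
      (\<Sum>n. ennreal ((q * r) ^ n * (q * (b - a)))))"
  proof (intro mult_left_mono add_mono suminf_le summableI)
    fix n
    have "ennreal (q ^ Suc n) * emeasure lebesgue (L n) \<le> ennreal (q ^ Suc n) * ennreal (r ^ n * (b - a))"
      by (intro mult_left_mono L) auto
    also have "\<dots> = ennreal ((q * r) ^ n * (q * (b - a)))"
      using q by (simp add: ennreal_mult'[symmetric] power_mult_distrib mult_ac)
    finally show "ennreal (q ^ Suc n) * emeasure lebesgue (L n) \<le> ennreal ((q * r) ^ n * (q * (b - a)))" .
  qed (use assms(1) in auto)
  also have "(\<Sum>n. ennreal ((q * r) ^ n * (q * (b - a)))) = ennreal (\<Sum>n. (q * r) ^ n * (q * (b - a)))"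
    using q r assms(1) summable by (intro suminf_ennreal2 summable_mult2) auto
  also have "(\<Sum>n. (q * r) ^ n * (q * (b - a))) = 1 / (1 - q * r) * (q * (b - a))"
    using assms(8) q r by (subst suminf_mult2[OF summable, symmetric]) (simp add: suminf_geometric)
  also have "ennreal (c powr - \<epsilon>) * (ennreal (b - a) + ennreal (1 / (1 - q * r) * (q * (b - a))))
      = ennreal (c powr - \<epsilon> * (1 + q / (1 - q * r)) * (b - a))"
    using assms(1,8) q
    by (simp add: ennreal_plus[symmetric] ennreal_mult'[symmetric] field_simps del: ennreal_plus)
  finally show ?thesis .
qed

text \<open>
  The average \<open>A\<close> of \<open>g\<close> over the left half bounds the averages over \<open>(a, x)\<close> from below by \<open>A / 2\<close>
  for all \<open>x\<close> in the right half, since \<open>(a, x)\<close> is at most twice as long as the left half.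
\<close>

lemma negative_moment_bound:
  obtains \<epsilon> M where "0 < \<epsilon>" "0 < M"
    "\<And>a b. a < b \<Longrightarrow> 0 < integral {a..(a + b) / 2} g \<Longrightarrow>
       (\<integral>\<^sup>+x\<in>right_half a b. ennreal (g x powr - \<epsilon>) \<partial>lebesgue)
         \<le> ennreal (M * ((b - a) / 2) * (integral {a..(a + b) / 2} g / ((b - a) / 2)) powr - \<epsilon>)"
proof -
  \<comment> \<open>This \<open>K\<close> makes \<open>s * (K / (K - 1)) = 2 * s / (1 + s)\<close>, which is less than \<open>1\<close>.\<close>
  define K where "K = 2 / (1 - s)"
  define r where "r = s * (K / (K - 1))"
  have K: "1 < K" using s by (simp add: K_def field_simps)
  have "K - 1 = (1 + s) / (1 - s)" using s by (simp add: K_def field_simps)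
  then have "K / (K - 1) = 2 / (1 - s) / ((1 + s) / (1 - s))" by (simp only: K_def)
  also have "\<dots> = 2 / (1 + s)"
    using s divide_divide_eq_left[of 2 "1 - s" "(1 + s) / (1 - s)"]
      nonzero_mult_div_cancel_left[of "1 - s" "1 + s"] by simp
  finally have "r = 2 * s / (1 + s)" by (simp add: r_def)
  then have r: "0 < r" "r < 1" using s by (simp_all add: divide_less_eq)
  have \<theta>: "0 < \<beta> / K" "\<beta> / K < 1" using K \<beta> by (auto simp: field_simps)
  \<comment> \<open>With this \<open>\<epsilon>\<close>, the factor \<open>(\<beta> / K) powr - \<epsilon>\<close> equals \<open>1 / sqrt r\<close>, so the ratio is \<open>sqrt r\<close>.\<close>
  define \<epsilon> where "\<epsilon> = ln r / (2 * ln (\<beta> / K))"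
  have \<epsilon>: "0 < \<epsilon>" using r \<theta> by (simp add: \<epsilon>_def divide_neg_neg)
  define q where "q = (\<beta> / K) powr - \<epsilon>"
  have "ln r / (2 * x) * x = ln r / 2" if "x < 0" for x :: real
    using that by simp
  from this[OF ln_less_zero[OF \<theta>]] have "\<epsilon> * ln (\<beta> / K) = ln r / 2"
    by (simp only: \<epsilon>_def)
  then have "q = exp (- (ln r / 2))"
    using \<beta> K by (simp add: q_def powr_def)
  then have "q * r = exp (- (ln r / 2)) * exp (ln r)" using r by simp
  also have "\<dots> = exp (ln r / 2)" by (simp flip: exp_add)
  finally have qr: "q * r < 1" using r by simp
  have q: "0 < q" unfolding q_def using \<beta> K by simp
  define M where "M = 2 * 2 powr \<epsilon> * (1 + q / (1 - q * r))"
  show ?thesis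
  proof (rule that[OF \<epsilon>, of M])
    show "0 < M" using q qr by (auto simp: M_def intro!: mult_pos_pos add_pos_nonneg)
    fix a b :: real assume ab: "a < b" and pos: "0 < integral {a..(a + b) / 2} g"
    define m A where "m = (a + b) / 2" and "A = integral {a..m} g / ((b - a) / 2)"
    have m: "a < m" "m < b" "m - a = (b - a) / 2" using ab by (auto simp: m_def field_simps)
    have A: "0 < A" using pos ab by (simp add: A_def m_def)
    have "A / 2 * (x - a) \<le> integral {a..x} g" if "x \<in> {m..b}" for x
    proof -
      have "A / 2 * (x - a) \<le> A / 2 * (b - a)"
        using A that by (intro mult_left_mono) auto
      also have "\<dots> = A * ((b - a) / 2)" by simp
      also have "\<dots> = integral {a..m} g"
        using ab by (intro nonzero_eq_divide_eq[THEN iffD1, OF _ A_def]) simp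
      also have "\<dots> \<le> integral {a..x} g" using m that by (intro integral_mono_right) auto
      finally show ?thesis .
    qed
    then obtain a' where a': "a \<le> a'" "a' \<le> m"
      "\<And>x. x \<in> {a'..b} \<Longrightarrow> A / 2 * (x - a') \<le> integral {a'..x} g"
      using obtain_good_left_endpoint[of a m b "A / 2"] m by auto
    have "(\<integral>\<^sup>+x\<in>right_half a b. ennreal (g x powr - \<epsilon>) \<partial>lebesgue)
        \<le> (\<integral>\<^sup>+x\<in>{a'<..<b}. ennreal (g x powr - \<epsilon>) \<partial>lebesgue)"
      using a' by (intro nn_integral_mono) (auto simp: right_half_def m_def indicator_def)
    also have "\<dots> \<le> ennreal ((A / 2) powr - \<epsilon> * (1 + q / (1 - q * r)) * (b - a'))"
      using negative_moment[of a' b "A / 2" K \<epsilon>] a' m A K \<epsilon> qr by (simp add: q_def r_def)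
    also have "\<dots> \<le> ennreal ((A / 2) powr - \<epsilon> * (1 + q / (1 - q * r)) * (b - a))"
      using a' q qr by (intro ennreal_leI mult_left_mono) auto
    also have "(A / 2) powr - \<epsilon> * (1 + q / (1 - q * r)) * (b - a) = M * ((b - a) / 2) * A powr - \<epsilon>"
      using A by (simp add: M_def powr_divide powr_minus_divide field_simps)
    finally show "(\<integral>\<^sup>+x\<in>right_half a b. ennreal (g x powr - \<epsilon>) \<partial>lebesgue)
         \<le> ennreal (M * ((b - a) / 2) * (integral {a..(a + b) / 2} g / ((b - a) / 2)) powr - \<epsilon>)"
      by (simp add: A_def m_def)
  qed
qed

end

section \<open>Weights as real functions, and maximal medians\<close>

lemma weight_AE_eq_ennreal:
  assumes "weight w"
  shows "AE x in lebesgue. w x = ennreal (enn2real (w x))"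
proof -
  have [measurable]: "w \<in> borel_measurable lebesgue" using assms by (simp add: weight_def)
  have "AE x in lebesgue. w x * indicator {- real n..real n} x \<noteq> \<infinity>" for n
  proof (rule nn_integral_PInf_AE)
    have [measurable]: "{- real n..real n} \<in> sets lebesgue" by simp
    show "(\<lambda>x. w x * indicator {- real n..real n} x) \<in> borel_measurable lebesgue"
      by measurable
    show "(\<integral>\<^sup>+x. w x * indicator {- real n..real n} x \<partial>lebesgue) \<noteq> \<infinity>"
      using assms by (auto simp: weight_def less_top[symmetric] dest!: spec[of _ "{- real n..real n}"])
  qed
  then have "AE x in lebesgue. \<forall>n. w x * indicator {- real n..real n} x \<noteq> \<infinity>"
    by (simp add: AE_all_countable)
  then show ?thesis
  proof eventually_elim
    case (elim x)
    obtain n where "\<bar>x\<bar> \<le> real n" using real_arch_simple by blast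
    then have "x \<in> {- real n..real n}" by auto
    then have "w x \<noteq> \<infinity>" using elim[rule_format, of n] by simp
    then show ?case by (simp add: less_top)
  qed
qed

lemma weight_integral:
  assumes "weight w"
  shows "(\<lambda>x. enn2real (w x)) integrable_on {a..b}"
    and "(\<integral>\<^sup>+x\<in>{a<..<b}. w x \<partial>lebesgue) = ennreal (integral {a..b} (\<lambda>x. enn2real (w x)))"
proof -
  let ?g = "\<lambda>x. enn2real (w x)"
  have [measurable]: "w \<in> borel_measurable lebesgue" using assms by (simp add: weight_def)
  have [measurable]: "{a..b} \<in> sets lebesgue" by simp
  define r where "r = (\<integral>\<^sup>+x\<in>{a..b}. w x \<partial>lebesgue)"
  have r: "r < \<infinity>" using assms by (simp add: weight_def r_def)
  have "(\<integral>\<^sup>+x. ennreal (if x \<in> {a..b} then ?g x else 0) \<partial>lebesgue) = r"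
    unfolding r_def
  proof (rule nn_integral_cong_AE)
    show "AE x in lebesgue. ennreal (if x \<in> {a..b} then ?g x else 0) = w x * indicator {a..b} x"
      using weight_AE_eq_ennreal[OF assms] by eventually_elim (auto simp: indicator_def)
  qed
  moreover have "(\<lambda>x. if x \<in> {a..b} then ?g x else 0) \<in> borel_measurable lebesgue"
    by measurable
  ultimately have "((\<lambda>x. if x \<in> {a..b} then ?g x else 0) has_integral enn2real r) UNIV"
    using r by (subst has_integral_iff_nn_integral_lebesgue) auto
  then have I: "(?g has_integral enn2real r) {a..b}"
    by (simp only: has_integral_restrict_UNIV)
  then show "?g integrable_on {a..b}" by blast
  have "{a, b} \<in> null_sets lebesgue"
    by (simp add: negligible_iff_null_sets[symmetric])
  then have "AE x in lebesgue. x \<notin> {a, b}"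
    by (rule AE_not_in)
  then have "(\<integral>\<^sup>+x\<in>{a<..<b}. w x \<partial>lebesgue) = r"
    unfolding r_def
    by (intro nn_integral_cong_AE, eventually_elim) (auto simp: indicator_def)
  then show "(\<integral>\<^sup>+x\<in>{a<..<b}. w x \<partial>lebesgue) = ennreal (integral {a..b} ?g)"
    using r integral_unique[OF I] by simp
qed

lemma average_interval:
  assumes "weight w" "a < b"
  shows "average w {a<..<b} = ennreal (integral {a..b} (\<lambda>x. enn2real (w x)) / (b - a))"
  unfolding average_def weight_integral(2)[OF assms(1)]
  using assms(2) by (simp add: divide_ennreal integral_nonneg[OF weight_integral(1)[OF assms(1)]])

lemma ennreal_powr_mono:
  assumes "x \<le> y" "0 < r"
  shows "ennreal_powr x r \<le> ennreal_powr y r"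
proof (cases "x = 0 \<or> y = \<infinity>")
  case True
  then show ?thesis using assms by (auto simp: ennreal_powr_def)
next
  case False
  then have "x \<noteq> \<infinity>" "y \<noteq> 0" using assms(1) by (auto simp: top_unique)
  moreover have "enn2real x \<le> enn2real y"
    using False assms(1) by (intro enn2real_mono) (auto simp: less_top)
  ultimately show ?thesis
    using False assms(2) by (auto simp: ennreal_powr_def intro!: ennreal_leI powr_mono2)
qed

lemma ennreal_powr_ennreal: "0 < x \<Longrightarrow> ennreal_powr (ennreal x) r = ennreal (x powr r)"
  by (auto simp: ennreal_powr_def)

lemma maximal_median_le:
  assumes "\<And>l'. l < l' \<Longrightarrow>
    ennreal s * emeasure lebesgue E < emeasure lebesgue {x \<in> E. f x < ereal l'}"
  shows "maximal_median s f E \<le> ereal l"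
  unfolding maximal_median_def
proof (rule SUP_least)
  fix l' assume "l' \<in> {l. emeasure lebesgue {x \<in> E. f x < ereal l} \<le> ennreal s * emeasure lebesgue E}"
  then show "ereal l' \<le> ereal l" using assms[of l'] by (cases "l < l'") auto
qed

lemma sublevel_above_maximal_median:
  assumes "maximal_median s f E < ereal l"
  shows "ennreal s * emeasure lebesgue E < emeasure lebesgue {x \<in> E. f x < ereal l}"
proof (rule ccontr)
  assume "\<not> ?thesis"
  then have "ereal l \<le> maximal_median s f E"
    unfolding maximal_median_def by (intro SUP_upper) auto
  with assms show False by auto
qed

lemma maximal_median_nonneg:
  assumes "\<And>x. 0 \<le> f x"
  shows "0 \<le> maximal_median s f E"
proof -
  have empty: "{x \<in> E. f x < ereal 0} = {}"
    using assms by (auto simp: not_less zero_ereal_def[symmetric])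
  then have "ereal 0 \<le> maximal_median s f E"
    unfolding maximal_median_def by (intro SUP_upper CollectI) (simp only: empty, simp)
  then show ?thesis by (simp add: zero_ereal_def)
qed

section \<open>From the median bound to the one-sided Muckenhoupt condition\<close>

text \<open>
  If \<open>{w < \<beta> * l}\<close> filled more than the proportion \<open>s\<close> of the right part, the maximal median
  there would be at most \<open>\<beta> * l\<close>, and (c) would bound the average over the left part by
  \<open>C * \<beta> * l \<le> l / 2\<close>, although it is at least \<open>l\<close>.
\<close>

lemma sparse_sublevels_of_median_bound:
  assumes w: "weight w" and \<gamma>: "0 < \<gamma>" "\<gamma> < 1" and s: "0 < s" "s < 1" and C: "0 < C"
    and bound: "\<And>a b. a < b \<Longrightarrow> median_bound w \<gamma> s C a b"
  shows "sparse_sublevels (\<lambda>x. enn2real (w x)) \<gamma> s (min (1 / 2) (1 / (2 * C)))"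
proof
  let ?g = "\<lambda>x. enn2real (w x)" and ?\<beta> = "min (1 / 2) (1 / (2 * C))"
  have w_meas [measurable]: "w \<in> borel_measurable lebesgue" using w by (simp add: weight_def)
  show "?g \<in> borel_measurable lebesgue" by measurable
  show "?g integrable_on {a..b}" for a b by (rule weight_integral(1)[OF w])
  show \<beta>: "0 < ?\<beta>" "?\<beta> < 1" using C by auto
  fix u t l :: real
  assume ut: "u < t" and l: "0 < l" and ge: "l * (\<gamma> * (t - u)) \<le> integral {u..u + \<gamma> * (t - u)} ?g"
  define h where "h = \<gamma> * (t - u)"
  have h: "0 < h" using \<gamma> ut by (simp add: h_def)
  define R where "R = right_part \<gamma> u t"
  have R: "R = {t - h<..<t}" by (simp add: R_def right_part_def h_def)
  have [measurable]: "R \<in> sets lebesgue" by (simp add: R)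
  have "ennreal l \<le> average w (left_part \<gamma> u t)"
    unfolding left_part_def using average_interval[OF w, of u "u + \<gamma> * (t - u)"] h ge
    by (simp add: h_def[symmetric] ennreal_leI field_simps)
  then have "enn2ereal (ennreal l) \<le> enn2ereal (average w (left_part \<gamma> u t))"
    by (simp add: less_eq_ennreal.rep_eq)
  then have lower: "ereal l \<le> ereal C * maximal_median s (\<lambda>x. enn2ereal (w x)) R"
    using bound[OF ut] l by (simp add: median_bound_def R_def enn2ereal_ennreal)
  have fin: "{x. ?g x < ?\<beta> * l} \<inter> R \<in> lmeasurable"
  proof -
    have "{x \<in> space lebesgue. ?g x < ?\<beta> * l} \<in> sets lebesgue" by measurable
    then show ?thesis
      using fmeasurable_Int_fmeasurable[of R lebesgue "{x. ?g x < ?\<beta> * l}"]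
      by (simp add: R Int_commute)
  qed
  show "measure lebesgue ({x. ?g x < ?\<beta> * l} \<inter> right_part \<gamma> u t) \<le> s * (\<gamma> * (t - u))"
  proof (rule ccontr)
    assume "\<not> ?thesis"
    then have less: "s * h < measure lebesgue ({x. ?g x < ?\<beta> * l} \<inter> R)"
      unfolding R_def h_def by (rule not_le_imp_less)
    have "0 \<le> s * h" using h s by simp
    then have "ennreal (s * h) < emeasure lebesgue ({x. ?g x < ?\<beta> * l} \<inter> R)"
      unfolding emeasure_eq_measure2[OF fin] by (rule ennreal_less_iff[THEN iffD2]) (rule less)
    moreover have "emeasure lebesgue R = ennreal h" using h by (simp add: R)
    ultimately have big: "ennreal s * emeasure lebesgue R < emeasure lebesgue ({x. ?g x < ?\<beta> * l} \<inter> R)"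
      using s h by (simp only: ennreal_mult less_imp_le)
    have "maximal_median s (\<lambda>x. enn2ereal (w x)) R \<le> ereal (?\<beta> * l)"
    proof (rule maximal_median_le)
      fix l' assume l': "?\<beta> * l < l'"
      note big
      also have "emeasure lebesgue ({x. ?g x < ?\<beta> * l} \<inter> R) \<le>
          emeasure lebesgue {x \<in> R. enn2ereal (w x) < ereal l'}"
      proof (rule emeasure_mono_AE)
        show "AE x in lebesgue. x \<in> {x. ?g x < ?\<beta> * l} \<inter> R \<longrightarrow> x \<in> {x \<in> R. enn2ereal (w x) < ereal l'}"
          using weight_AE_eq_ennreal[OF w]
        proof eventually_elim
          case (elim x)
          then have "enn2ereal (w x) = ereal (?g x)"
            using enn2ereal_ennreal[of "?g x"] by simp
          then show ?case using l' by auto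
        qed
        have "{x \<in> space lebesgue. x \<in> R \<and> enn2ereal (w x) < ereal l'} \<in> sets lebesgue"
          by measurable
        then show "{x \<in> R. enn2ereal (w x) < ereal l'} \<in> sets lebesgue" by simp
      qed
      finally show "ennreal s * emeasure lebesgue R < emeasure lebesgue {x \<in> R. enn2ereal (w x) < ereal l'}" .
    qed
    then have "ereal C * maximal_median s (\<lambda>x. enn2ereal (w x)) R \<le> ereal C * ereal (?\<beta> * l)"
      using C by (intro ereal_mult_left_mono) auto
    with lower have "l \<le> C * (?\<beta> * l)" by (metis ereal_less_eq(3) order_trans times_ereal.simps(1))
    moreover have "C * ?\<beta> \<le> C * (1 / (2 * C))" using C by (intro mult_left_mono) auto
    then have "C * ?\<beta> * l \<le> 1 / 2 * l" using C l by (intro mult_right_mono) auto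
    ultimately show False using l by (simp add: mult.assoc)
  qed
qed (use \<gamma> s in auto)

text \<open>
  With \<open>p = 1 + 1 / \<epsilon>\<close> the dual weight is \<open>w powr - \<epsilon>\<close>. Its average over the right half is at
  most \<open>M * A powr - \<epsilon>\<close>, where \<open>A\<close> is the average of \<open>w\<close> over the left half, and the power
  \<open>1 / \<epsilon> = p - 1\<close> turns this into a multiple of \<open>1 / A\<close>. If \<open>A = 0\<close>, the product is \<open>0\<close>.
\<close>

lemma Ap_plus_of_median_bound:
  assumes w: "weight w" and \<gamma>: "0 < \<gamma>" "\<gamma> < 1" and s: "0 < s" "s < 1" and C: "0 < C"
    and bound: "\<And>a b. a < b \<Longrightarrow> median_bound w \<gamma> s C a b"
  shows "\<exists>p>1. w \<in> Ap_plus p"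
proof -
  let ?g = "\<lambda>x. enn2real (w x)"
  interpret sparse_sublevels ?g \<gamma> s "min (1 / 2) (1 / (2 * C))"
    using assms by (rule sparse_sublevels_of_median_bound)
  obtain \<epsilon> M where \<epsilon>: "0 < \<epsilon>" and M: "0 < M" and
    moment: "\<And>a b. a < b \<Longrightarrow> 0 < integral {a..(a + b) / 2} ?g \<Longrightarrow>
       (\<integral>\<^sup>+x\<in>right_half a b. ennreal (?g x powr - \<epsilon>) \<partial>lebesgue)
         \<le> ennreal (M * ((b - a) / 2) * (integral {a..(a + b) / 2} ?g / ((b - a) / 2)) powr - \<epsilon>)"
    using negative_moment_bound by blast
  have dual: "AE x in lebesgue. ennreal_powr (w x) (- \<epsilon>) = ennreal (?g x powr - \<epsilon>)"
  proof -
    have "AE x in lebesgue. 0 < w x" using w by (simp add: weight_def)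
    with weight_AE_eq_ennreal[OF w] show ?thesis
    proof eventually_elim
      case (elim x)
      then have "w x \<noteq> \<infinity>" by (metis ennreal_neq_top infinity_ennreal_def)
      with elim show ?case by (auto simp: ennreal_powr_def)
    qed
  qed
  define p where "p = 1 + 1 / \<epsilon>"
  have p: "1 < p" "p - 1 = 1 / \<epsilon>" "- 1 / (p - 1) = - \<epsilon>" using \<epsilon> by (auto simp: p_def)
  have "average w (left_half a b) *
      ennreal_powr (average (\<lambda>x. ennreal_powr (w x) (- 1 / (p - 1))) (right_half a b)) (p - 1)
      \<le> ennreal (M powr (1 / \<epsilon>))" if ab: "a < b" for a b
  proof -
    define h where "h = (b - a) / 2"
    define A where "A = integral {a..(a + b) / 2} ?g / h"
    have h: "0 < h" "(a + b) / 2 - a = h" "b - (a + b) / 2 = h"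
      using ab by (auto simp: h_def field_simps)
    have A: "average w (left_half a b) = ennreal A"
      unfolding left_half_def A_def using average_interval[OF w, of a "(a + b) / 2"] h by simp
    show ?thesis
    proof (cases "0 < A")
      case False
      then show ?thesis using A by (simp add: ennreal_neg)
    next
      case True
      have "(\<integral>\<^sup>+x\<in>right_half a b. ennreal_powr (w x) (- \<epsilon>) \<partial>lebesgue)
          = (\<integral>\<^sup>+x\<in>right_half a b. ennreal (?g x powr - \<epsilon>) \<partial>lebesgue)"
        using dual by (intro nn_integral_cong_AE) (auto elim!: eventually_mono)
      also have "\<dots> \<le> ennreal (M * h * A powr - \<epsilon>)"
        using moment[OF ab] True h(1) by (simp add: A_def h_def[symmetric] zero_less_divide_iff)
      finally have "average (\<lambda>x. ennreal_powr (w x) (- \<epsilon>)) (right_half a b)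
          \<le> ennreal (M * h * A powr - \<epsilon>) / ennreal h"
        unfolding average_def using h by (simp add: right_half_def divide_right_mono_ennreal)
      also have "\<dots> = ennreal (M * A powr - \<epsilon>)"
        using h M by (simp add: divide_ennreal)
      finally have "ennreal_powr (average (\<lambda>x. ennreal_powr (w x) (- \<epsilon>)) (right_half a b)) (1 / \<epsilon>)
          \<le> ennreal_powr (ennreal (M * A powr - \<epsilon>)) (1 / \<epsilon>)"
        using \<epsilon> by (intro ennreal_powr_mono) auto
      also have "\<dots> = ennreal (M powr (1 / \<epsilon>) * (A powr - \<epsilon>) powr (1 / \<epsilon>))"
        using M True by (simp add: ennreal_powr_ennreal powr_mult)
      also have "(A powr - \<epsilon>) powr (1 / \<epsilon>) = 1 / A"
        using True \<epsilon> unfolding powr_powr by (simp add: powr_minus_divide)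
      finally have "ennreal A * ennreal_powr (average (\<lambda>x. ennreal_powr (w x) (- \<epsilon>)) (right_half a b)) (1 / \<epsilon>)
          \<le> ennreal A * ennreal (M powr (1 / \<epsilon>) * (1 / A))"
        by (intro mult_left_mono) auto
      also have "\<dots> = ennreal (M powr (1 / \<epsilon>))"
        using True by (simp add: ennreal_mult'[symmetric])
      finally show ?thesis unfolding A p(3) unfolding p(2) .
    qed
  qed
  then have "(SUP (a, b) \<in> {(a, b). a < b}. average w (left_half a b) *
        ennreal_powr (average (\<lambda>x. ennreal_powr (w x) (- 1 / (p - 1))) (right_half a b)) (p - 1))
     \<le> ennreal (M powr (1 / \<epsilon>))"
    by (intro SUP_least) auto
  also have "\<dots> < \<infinity>" by simp
  finally have "w \<in> Ap_plus p" using w by (simp add: Ap_plus_def)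
  then show ?thesis using p(1) by blast
qed

section \<open>From the one-sided Muckenhoupt condition to the median bound\<close>

text \<open>
  It suffices to compare the average with every real \<open>l\<close> above the maximal median. Since
  \<open>\<gamma> \<le> 1 / 2\<close>, the left and right parts lie in the left and right halves, and passing to the
  halves costs only constants.
\<close>

lemma median_bound_of_Ap_plus:
  assumes "1 < p" and A: "w \<in> Ap_plus p" and \<gamma>: "0 < \<gamma>" "\<gamma> \<le> 1 / 2" and s: "0 < s" "s < 1"
  shows "\<exists>C>0. \<forall>a b. a < b \<longrightarrow> median_bound w \<gamma> s C a b"
proof -
  define r where "r = p - 1"
  have r: "0 < r" using assms(1) by (simp add: r_def)
  let ?\<sigma> = "\<lambda>x. ennreal_powr (w x) (- 1 / r)"
  have w: "weight w" using A by (simp add: Ap_plus_def)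
  have w_meas [measurable]: "w \<in> borel_measurable lebesgue" using w by (simp add: weight_def)
  define B where "B = (SUP (a, b) \<in> {(a, b). a < b}. average w (left_half a b) *
        ennreal_powr (average ?\<sigma> (right_half a b)) r)"
  have "B < \<infinity>" using A by (simp add: Ap_plus_def B_def r_def)
  define B' where "B' = enn2real B"
  have B': "0 \<le> B'" "B = ennreal B'" using \<open>B < \<infinity>\<close> by (auto simp: B'_def)
  have Ap: "average w (left_half a b) * ennreal_powr (average ?\<sigma> (right_half a b)) r \<le> ennreal B'"
    if "a < b" for a b
    unfolding B'(2)[symmetric] B_def using that by (intro SUP_upper2[of "(a, b)"]) auto
  define d where "d = (2 * \<gamma> * s) powr r"
  have d: "0 < d" using \<gamma> s by (simp add: d_def)
  \<comment> \<open>The summand \<open>1\<close> keeps \<open>C\<close> positive in case the supremum is \<open>0\<close>.\<close>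
  define C where "C = (B' + 1) / d / (2 * \<gamma>)"
  have C: "0 < C" using B' d \<gamma> by (simp add: C_def)
  have key: "average w (left_part \<gamma> a b) \<le> ennreal (C * l)"
    if ab: "a < b" and l: "0 < l" and big: "ennreal s * emeasure lebesgue (right_part \<gamma> a b) <
      emeasure lebesgue {x \<in> right_part \<gamma> a b. enn2ereal (w x) < ereal l}" for a b l
  proof -
    define h where "h = (b - a) / 2"
    have h: "0 < h" "(a + b) / 2 - a = h" "b - (a + b) / 2 = h" "b - a = 2 * h"
      using ab by (auto simp: h_def field_simps)
    have \<gamma>h: "\<gamma> * (2 * h) \<le> h" using \<gamma> h(1) mult_right_mono[of \<gamma> "1 / 2" "2 * h"] by simp
    have meas: "emeasure lebesgue (left_part \<gamma> a b) = ennreal (2 * \<gamma> * h)"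
       "emeasure lebesgue (right_part \<gamma> a b) = ennreal (2 * \<gamma> * h)"
       "emeasure lebesgue (left_half a b) = ennreal h"
       "emeasure lebesgue (right_half a b) = ennreal h"
      unfolding left_part_def right_part_def left_half_def right_half_def
      using h \<gamma> by (simp_all add: mult_ac)
    have sub: "left_part \<gamma> a b \<subseteq> left_half a b" "right_part \<gamma> a b \<subseteq> right_half a b"
      using \<gamma>h h(2,3) unfolding left_part_def left_half_def right_part_def right_half_def h(4)
      by (auto simp only: greaterThanLessThan_iff)
    define X where "X = average w (left_half a b)"
    define E where "E = {x \<in> right_part \<gamma> a b. enn2ereal (w x) < ereal l}"
    have E: "E \<in> sets lebesgue"
    proof -
      have [measurable]: "right_part \<gamma> a b \<in> sets lebesgue" by (simp add: right_part_def)
      have "{x \<in> space lebesgue. x \<in> right_part \<gamma> a b \<and> enn2ereal (w x) < ereal l} \<in> sets lebesgue"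
        by measurable
      then show ?thesis by (simp add: E_def)
    qed
    have \<sigma>_ge: "ennreal (l powr (- 1 / r)) \<le> ?\<sigma> x" if "x \<in> E" for x
    proof (cases "w x = 0")
      case True
      then show ?thesis using r by (simp add: ennreal_powr_def)
    next
      case False
      have *: "enn2ereal (w x) < ereal l" using that by (simp add: E_def)
      then obtain y where y: "0 \<le> y" "w x = ennreal y"
        by (cases "w x") auto
      then have "0 < y" "y < l" using * False by (auto simp: enn2ereal_ennreal)
      then show ?thesis
        using r by (auto simp: y ennreal_powr_ennreal intro!: ennreal_leI powr_mono2')
    qed
    have "ennreal (l powr (- 1 / r) * (2 * \<gamma> * s * h)) =
        ennreal (l powr (- 1 / r)) * (ennreal s * ennreal (2 * \<gamma> * h))"
      using s \<gamma> h by (simp add: ennreal_mult'[symmetric] mult_ac)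
    also have "\<dots> \<le> ennreal (l powr (- 1 / r)) * emeasure lebesgue E"
      using big by (intro mult_left_mono) (auto simp: E_def meas)
    also have "\<dots> = (\<integral>\<^sup>+x. ennreal (l powr (- 1 / r)) * indicator E x \<partial>lebesgue)"
      using E by (rule nn_integral_cmult_indicator[symmetric])
    also have "\<dots> \<le> (\<integral>\<^sup>+x\<in>right_half a b. ?\<sigma> x \<partial>lebesgue)"
      using \<sigma>_ge sub(2) by (intro nn_integral_mono) (auto simp: indicator_def E_def)
    finally have "ennreal (l powr (- 1 / r) * (2 * \<gamma> * s * h)) / ennreal h \<le> average ?\<sigma> (right_half a b)"
      unfolding average_def meas by (rule divide_right_mono_ennreal)
    also have "ennreal (l powr (- 1 / r) * (2 * \<gamma> * s * h)) / ennreal h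
        = ennreal (l powr (- 1 / r) * (2 * \<gamma> * s))"
      using h(1) s \<gamma> by (subst divide_ennreal) auto
    finally have "ennreal_powr (ennreal (l powr (- 1 / r) * (2 * \<gamma> * s))) r
        \<le> ennreal_powr (average ?\<sigma> (right_half a b)) r"
      using r by (rule ennreal_powr_mono)
    moreover have "ennreal_powr (ennreal (l powr (- 1 / r) * (2 * \<gamma> * s))) r = ennreal (d / l)"
    proof -
      have "(l powr (- 1 / r) * (2 * \<gamma> * s)) powr r = (l powr (- 1 / r)) powr r * d"
        unfolding d_def using \<gamma> s by (intro powr_mult)
      also have "\<dots> = d / l" using r l unfolding powr_powr by (simp add: powr_minus_divide)
      finally show ?thesis using l \<gamma> s by (simp add: ennreal_powr_ennreal)
    qed
    ultimately have "X * ennreal (d / l) \<le> X * ennreal_powr (average ?\<sigma> (right_half a b)) r"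
      by (intro mult_left_mono) auto
    also have "\<dots> \<le> ennreal B'" unfolding X_def by (rule Ap[OF ab])
    also have "\<dots> \<le> ennreal (B' + 1)" by (intro ennreal_leI) simp
    finally have le: "X * ennreal (d / l) \<le> ennreal (B' + 1)" .
    have "X \<le> ennreal ((B' + 1) * l / d)"
    proof (cases X)
      case (real y)
      then have "ennreal (y * (d / l)) \<le> ennreal (B' + 1)"
        using le by (simp only: ennreal_mult')
      then have "y * (d / l) \<le> B' + 1"
        using B'(1) by (simp add: ennreal_le_iff del: ennreal_plus)
      then have "y \<le> (B' + 1) * l / d" using d l by (simp add: field_simps)
      then show ?thesis unfolding real by (rule ennreal_leI)
    next
      case top
      then show ?thesis using le d l by (simp add: ennreal_top_mult top_unique)
    qed
    then have "X * ennreal h \<le> ennreal ((B' + 1) * l / d) * ennreal h"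
      by (intro mult_right_mono) auto
    moreover have "X * ennreal h = (\<integral>\<^sup>+x\<in>left_half a b. w x \<partial>lebesgue)"
      unfolding X_def average_def meas using h(1)
      by (simp add: ennreal_divide_times ennreal_mult_divide_eq)
    moreover have "(\<integral>\<^sup>+x\<in>left_part \<gamma> a b. w x \<partial>lebesgue) \<le> (\<integral>\<^sup>+x\<in>left_half a b. w x \<partial>lebesgue)"
      using sub(1) by (intro nn_integral_mono) (auto simp: indicator_def)
    ultimately have "(\<integral>\<^sup>+x\<in>left_part \<gamma> a b. w x \<partial>lebesgue) \<le> ennreal ((B' + 1) * l / d) * ennreal h"
      by order
    then have "average w (left_part \<gamma> a b) \<le> ennreal ((B' + 1) * l / d) * ennreal h / ennreal (2 * \<gamma> * h)"
      unfolding average_def meas by (rule divide_right_mono_ennreal)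
    also have "\<dots> = ennreal (C * l)"
      using d l B' h(1) \<gamma> by (simp add: ennreal_mult'[symmetric] divide_ennreal C_def)
    finally show ?thesis .
  qed
  have "median_bound w \<gamma> s C a b" if ab: "a < b" for a b
  proof -
    let ?m = "maximal_median s (\<lambda>x. enn2ereal (w x)) (right_part \<gamma> a b)"
    have "enn2ereal (average w (left_part \<gamma> a b)) / ereal C \<le> ?m"
    proof (rule dense_ge)
      fix y assume y: "?m < y"
      moreover have "0 \<le> ?m" by (intro maximal_median_nonneg) simp
      ultimately have "0 < y" by order
      show "enn2ereal (average w (left_part \<gamma> a b)) / ereal C \<le> y"
      proof (cases y)
        case (real l)
        then have l: "0 < l" using \<open>0 < y\<close> by simp
        have "average w (left_part \<gamma> a b) \<le> ennreal (C * l)"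
          using y real by (intro key[OF ab l] sublevel_above_maximal_median) simp
        then have "enn2ereal (average w (left_part \<gamma> a b)) \<le> ereal C * ereal l"
          using C l by (simp add: less_eq_ennreal.rep_eq enn2ereal_ennreal)
        then show ?thesis using C real by (simp add: ereal_divide_le_pos)
      qed (use \<open>0 < y\<close> in auto)
    qed
    then show ?thesis using C by (simp add: median_bound_def ereal_divide_le_pos)
  qed
  then show ?thesis using C by blast
qed

section \<open>Equivalence of the three conditions\<close>

theorem theorem1p5:
  fixes w :: "real \<Rightarrow> ennreal"
  assumes "weight w"
  shows "((\<exists>p>1. w \<in> Ap_plus p)
            \<longleftrightarrow>
          (\<forall>\<gamma> s. 0 < \<gamma> \<and> \<gamma> \<le> 1 / 2 \<and> 0 < s \<and> s < 1 \<longrightarrow>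
             (\<exists>C>0. \<forall>a b. a < b \<longrightarrow> median_bound w \<gamma> s C a b)))
       \<and> ((\<forall>\<gamma> s. 0 < \<gamma> \<and> \<gamma> \<le> 1 / 2 \<and> 0 < s \<and> s < 1 \<longrightarrow>
             (\<exists>C>0. \<forall>a b. a < b \<longrightarrow> median_bound w \<gamma> s C a b))
            \<longleftrightarrow>
          (\<exists>\<gamma> s C. 0 < \<gamma> \<and> \<gamma> \<le> 1 / 2 \<and> 0 < s \<and> s < 1 \<and> 0 < C \<and>
             (\<forall>a b. a < b \<longrightarrow> median_bound w \<gamma> s C a b)))"
proof -
  let ?a = "\<exists>p>1. w \<in> Ap_plus p"
  let ?b = "\<forall>\<gamma> s. 0 < \<gamma> \<and> \<gamma> \<le> 1 / 2 \<and> 0 < s \<and> s < 1 \<longrightarrow>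
             (\<exists>C>0. \<forall>a b. a < b \<longrightarrow> median_bound w \<gamma> s C a b)"
  let ?c = "\<exists>\<gamma> s C. 0 < \<gamma> \<and> \<gamma> \<le> 1 / 2 \<and> 0 < s \<and> s < 1 \<and> 0 < C \<and>
             (\<forall>a b. a < b \<longrightarrow> median_bound w \<gamma> s C a b)"
  have "?a \<Longrightarrow> ?b"
    using median_bound_of_Ap_plus by blast
  moreover have ?c if b: ?b
  proof -
    obtain C where "0 < C" "\<forall>a b. a < b \<longrightarrow> median_bound w (1 / 2) (1 / 2) C a b"
      using b[rule_format, of "1 / 2" "1 / 2"] by auto
    then show ?thesis
      by (intro exI[of _ "1 / 2"] exI[of _ "1 / 2"] exI[of _ C]) simp
  qed
  moreover have ?a if c: ?c
  proof -
    obtain \<gamma> s C where "0 < \<gamma>" "\<gamma> \<le> 1 / 2" "0 < s" "s < 1" "0 < C"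
      "\<And>a b. a < b \<Longrightarrow> median_bound w \<gamma> s C a b"
      using c by blast
    then show ?thesis
      using Ap_plus_of_median_bound[OF assms, of \<gamma> s C] by simp
  qed
  ultimately show ?thesis by blast
qed

end
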